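(* Let $\mathfrak{F}$ be a (nonempty) hereditary saturated formation of finite groups and let $\pi=\pi(\mathfrak{F})$. Then $\mathrm{O}^{\pi'}(\mathrm{NI}_{\mathfrak{F}}(G))=\mathrm{Int}_{\mathfrak{F}}(G)$ for every finite group $G$.
   Context: All groups are finite. Classes of groups are closed under isomorphism. A formation is a class of groups $\mathfrak{X}$ closed under quotients and such that $H/A, H/B\in\mathfrak{X}$ (with $A,B$ normal in $H$) implies $H/(A\cap B)\in\mathfrak{X}$. A class $\mathfrak{X}$ is hereditary if it is closed under subgroups, and saturated if $G/\Phi(G)\in\mathfrak{X}$ implies $G\in\mathfrak{X}$ ($\Phi(G)$ is the Frattini subgroup). $\pi(G)$ is the set of prime divisors of $|G|$ and $\pi(\mathfrak{X})=\bigcup_{G\in\mathfrak{X}}\pi(G)$. $\pi'$ is the complement of $\pi$ in the set of all primes. For a set of primes $\rho$, $\mathrm{O}^{\rho}(G)$ is the smallest normal subgroup of $G$ such that $\pi(G/\mathrm{O}^{\rho}(G))\subseteq\rho$. An $\mathfrak{F}$-maximal subgroup of $G$ is a subgroup $H\in\mathfrak{F}$ of $G$ such that $H\le K\le G$ and $K\in\mathfrak{F}$ imply $H=K$. $\mathrm{NI}_{\mathfrak{F}}(G)$ is the intersection of the normalizers $N_G(H)$ of all $\mathfrak{F}$-maximal subgroups $H$ of $G$, and $\mathrm{Int}_{\mathfrak{F}}(G)$ is the intersection of all $\mathfrak{F}$-maximal subgroups of $G$. *)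

theory Defs
  imports "HOL-Algebra.Algebra" "HOL-Computational_Algebra.Primes"
begin

(* A class of finite groups closed under isomorphism contains groups of every carrier type,
   which HOL cannot collect in a single set. Since every finite group is isomorphic to one
   with elements in nat (finite_group_nat_copy below), such a class is represented by the set
   of its members of type nat monoid, and in_class extends membership to all types. *)

type_synonym group_class = "nat monoid set"

definition group_class :: "group_class \<Rightarrow> bool" where
  "group_class \<XX> \<longleftrightarrow>
     (\<forall>K\<in>\<XX>. group K \<and> finite (carrier K)) \<and>
     (\<forall>K\<in>\<XX>. \<forall>L::nat monoid. group L \<longrightarrow> K \<cong> L \<longrightarrow> L \<in> \<XX>)"

definition in_class :: "('a, 'b) monoid_scheme \<Rightarrow> group_class \<Rightarrow> bool" where
  "in_class G \<XX> \<longleftrightarrow> group G \<and> finite (carrier G) \<and> (\<exists>K\<in>\<XX>. G \<cong> K)"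

lemma finite_group_nat_copy:
  assumes "group G" "finite (carrier G)"
  shows "\<exists>K::nat monoid. group K \<and> finite (carrier K) \<and> G \<cong> K"
proof -
  interpret group G by fact
  obtain f :: "'a \<Rightarrow> nat" where f: "inj_on f (carrier G)"
    using finite_imp_inj_to_nat_seg[OF assms(2)] by blast
  let ?K = "image_group f G"
  have iso: "f \<in> iso G ?K"
    using f by (rule inj_imp_image_group_iso)
  have "group ?K"
    using f by (rule inj_imp_image_group_is_group)
  moreover have "finite (carrier ?K)"
    by (simp add: image_group_def assms(2))
  ultimately show ?thesis
    using iso by (blast intro: is_isoI)
qed

lemma in_class_nat_iff:
  fixes K :: "nat monoid"
  assumes "group_class \<XX>"
  shows "in_class K \<XX> \<longleftrightarrow> K \<in> \<XX>"
  using assms iso_refl group.iso_sym unfolding group_class_def in_class_def by blast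

lemma in_class_iso:
  assumes "in_class G \<XX>" "group H" "G \<cong> H"
  shows "in_class H \<XX>"
proof -
  interpret G: group G using assms(1) by (simp add: in_class_def)
  have "H \<cong> G" using assms(3) by (rule G.iso_sym)
  then show ?thesis
    using assms iso_trans[of H G] iso_finite unfolding in_class_def by blast
qed

definition formation :: "group_class \<Rightarrow> bool" where
  "formation \<XX> \<longleftrightarrow> group_class \<XX> \<and>
     (\<forall>G\<in>\<XX>. \<forall>N. N \<lhd> G \<longrightarrow> in_class (G Mod N) \<XX>) \<and>
     (\<forall>H::nat monoid. \<forall>A B. group H \<longrightarrow> finite (carrier H) \<longrightarrow> A \<lhd> H \<longrightarrow> B \<lhd> H \<longrightarrow>
        in_class (H Mod A) \<XX> \<longrightarrow> in_class (H Mod B) \<XX> \<longrightarrow> in_class (H Mod (A \<inter> B)) \<XX>)"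

definition hereditary :: "group_class \<Rightarrow> bool" where
  "hereditary \<XX> \<longleftrightarrow> (\<forall>G\<in>\<XX>. \<forall>H. subgroup H G \<longrightarrow> in_class (G\<lparr>carrier := H\<rparr>) \<XX>)"

definition maximal_subgroup :: "'a set \<Rightarrow> ('a, 'b) monoid_scheme \<Rightarrow> bool" where
  "maximal_subgroup M G \<longleftrightarrow> subgroup M G \<and> M \<noteq> carrier G \<and>
     (\<forall>K. subgroup K G \<longrightarrow> M \<subseteq> K \<longrightarrow> K = M \<or> K = carrier G)"

(* Intersecting with the carrier gives the empty intersection its usual value G; this matters
   only for the trivial group. *)
definition frattini :: "('a, 'b) monoid_scheme \<Rightarrow> 'a set" where
  "frattini G = carrier G \<inter> \<Inter>{M. maximal_subgroup M G}"

definition saturated :: "group_class \<Rightarrow> bool" where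
  "saturated \<XX> \<longleftrightarrow>
     (\<forall>G::nat monoid. group G \<longrightarrow> finite (carrier G) \<longrightarrow>
        in_class (G Mod frattini G) \<XX> \<longrightarrow> in_class G \<XX>)"

definition prime_divs :: "('a, 'b) monoid_scheme \<Rightarrow> nat set" where
  "prime_divs G = {p. Factorial_Ring.prime p \<and> p dvd order G}"

definition class_primes :: "group_class \<Rightarrow> nat set" where
  "class_primes \<XX> = (\<Union>G\<in>\<XX>. prime_divs G)"

definition prime_compl :: "nat set \<Rightarrow> nat set" where
  "prime_compl \<rho> = {p. Factorial_Ring.prime p \<and> p \<notin> \<rho>}"

(* O^rho(G); LEAST refers to inclusion of sets. *)
definition residual :: "nat set \<Rightarrow> ('a, 'b) monoid_scheme \<Rightarrow> 'a set" where
  "residual \<rho> G = (LEAST N. N \<lhd> G \<and> prime_divs (G Mod N) \<subseteq> \<rho>)"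

definition class_maximal :: "group_class \<Rightarrow> 'a set \<Rightarrow> ('a, 'b) monoid_scheme \<Rightarrow> bool" where
  "class_maximal \<XX> H G \<longleftrightarrow> subgroup H G \<and> in_class (G\<lparr>carrier := H\<rparr>) \<XX> \<and>
     (\<forall>K. subgroup K G \<longrightarrow> H \<subseteq> K \<longrightarrow> in_class (G\<lparr>carrier := K\<rparr>) \<XX> \<longrightarrow> H = K)"

definition NI :: "group_class \<Rightarrow> ('a, 'b) monoid_scheme \<Rightarrow> 'a set" where
  "NI \<XX> G = carrier G \<inter> (\<Inter>H\<in>{H. class_maximal \<XX> H G}. normalizer G H)"

definition Int_class :: "group_class \<Rightarrow> ('a, 'b) monoid_scheme \<Rightarrow> 'a set" where
  "Int_class \<XX> G = carrier G \<inter> \<Inter>{H. class_maximal \<XX> H G}"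

end

theory Submission
  imports Defs
begin

text \<open>Write \<open>N\<close> for the intersection of the normalizers and \<open>I\<close> for the intersection of the maximal
  \<open>\<FF>\<close>-subgroups. Let \<open>K\<close> be generated by the \<open>\<pi>\<close>-elements of \<open>N\<close>, where \<open>\<pi> = \<pi>(\<FF>)\<close>. Everything reduces to
  \<open>HK \<in> \<FF>\<close> for each \<open>\<FF>\<close>-maximal \<open>H\<close>: then \<open>K \<subseteq> I\<close>, so \<open>I\<close> consists of exactly the \<open>\<pi>\<close>-elements of \<open>N\<close>.

  For this one may assume \<open>G = HK\<close>; the hypotheses pass to quotients, because saturation lifts
  \<open>\<FF>\<close>-maximal subgroups along surjections. Hence all proper quotients of \<open>G\<close> lie in \<open>\<FF>\<close> by induction on
  the order. Choose \<open>M \<subseteq> K\<close> minimal normal in \<open>G\<close> and an \<open>\<FF>\<close>-maximal \<open>U\<close> with \<open>UM = G\<close>. As \<open>M\<close> normalizes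
  \<open>U\<close>, both \<open>U\<close> and \<open>U \<inter> M\<close> are normal. Either \<open>M \<subseteq> U = G\<close>, or \<open>U \<inter> M = 1\<close>; then \<open>U = 1\<close> is impossible,
  since \<open>K\<close> contains a subgroup of prime order in \<open>\<pi>\<close>, and otherwise \<open>G/U\<close>, \<open>G/M \<in> \<FF>\<close> give \<open>G \<in> \<FF>\<close>.\<close>

section \<open>Auxiliary group theory: homomorphisms, conjugation, the Frattini subgroup, Cauchy's
  theorem\<close>

text \<open>The fundamental theorem on homomorphisms without a quotient group: \<open>g\<close> is
  constant on the fibres of \<open>h\<close>, hence factors through it. It serves for
  \<open>K Mod frattini K\<close> and for comparing cyclic groups of the same prime order.\<close>

lemma hom_factor:
  assumes "group G" "h \<in> hom G A" "h ` carrier G = carrier A"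
    and "group A" "group B" "g \<in> hom G B" "g ` carrier G = carrier B"
    and ker: "\<And>x. x \<in> carrier G \<Longrightarrow> h x = \<one>\<^bsub>A\<^esub> \<Longrightarrow> g x = \<one>\<^bsub>B\<^esub>"
  shows "\<exists>f\<in>hom A B. f ` carrier A = carrier B"
proof -
  interpret h: group_hom G A h
    using assms by (simp add: group_hom_def group_hom_axioms_def)
  interpret g: group_hom G B g
    using assms by (simp add: group_hom_def group_hom_axioms_def)
  have eq: "g x = g y" if "x \<in> carrier G" "y \<in> carrier G" "h x = h y" for x y
  proof -
    have "h (x \<otimes>\<^bsub>G\<^esub> inv\<^bsub>G\<^esub> y) = \<one>\<^bsub>A\<^esub>"
      using that by simp
    then have "g x \<otimes>\<^bsub>B\<^esub> inv\<^bsub>B\<^esub> g y = \<one>\<^bsub>B\<^esub>"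
      using that ker[of "x \<otimes>\<^bsub>G\<^esub> inv\<^bsub>G\<^esub> y"] by simp
    then show ?thesis
      using that by (metis g.H.inv_solve_right g.H.l_one g.H.one_closed g.hom_closed)
  qed
  define f where "f a = g (inv_into (carrier G) h a)" for a
  have f: "f (h x) = g x" if "x \<in> carrier G" for x
    unfolding f_def
  proof (rule eq)
    have "h x \<in> h ` carrier G" using that by blast
    then show "inv_into (carrier G) h (h x) \<in> carrier G" "h (inv_into (carrier G) h (h x)) = h x"
      by (rule inv_into_into, rule f_inv_into_f)
  qed fact
  have "f \<in> hom A B"
  proof (rule homI)
    show "f a \<in> carrier B" if "a \<in> carrier A" for a
    proof -
      from that have "a \<in> h ` carrier G" by (simp only: assms(3))
      then obtain x where "a = h x" "x \<in> carrier G" by (rule imageE)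
      then show ?thesis using f[of x] g.hom_closed[of x] by metis
    qed
    show "f (a \<otimes>\<^bsub>A\<^esub> b) = f a \<otimes>\<^bsub>B\<^esub> f b" if "a \<in> carrier A" "b \<in> carrier A" for a b
    proof -
      from that have "a \<in> h ` carrier G" "b \<in> h ` carrier G" by (simp_all only: assms(3))
      then obtain x y where xy: "x \<in> carrier G" "y \<in> carrier G" "a = h x" "b = h y"
        by (elim imageE)
      have "f (a \<otimes>\<^bsub>A\<^esub> b) = f (h (x \<otimes>\<^bsub>G\<^esub> y))"
        using xy by simp
      also have "\<dots> = g (x \<otimes>\<^bsub>G\<^esub> y)"
        using xy by (intro f) simp
      finally show ?thesis
        using xy f by simp
    qed
  qed
  moreover have "f ` h ` carrier G = g ` carrier G"
    unfolding image_image using f by (rule image_cong[OF refl])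
  then have "f ` carrier A = carrier B" by (simp only: assms(3,7))
  ultimately show ?thesis by blast
qed

lemma hom_conj_closed_image:
  assumes "group_hom G H h" "subgroup U G" "x \<in> carrier G"
    and "\<And>u. u \<in> U \<Longrightarrow> x \<otimes>\<^bsub>G\<^esub> u \<otimes>\<^bsub>G\<^esub> inv\<^bsub>G\<^esub> x \<in> U"
    and "v \<in> h ` U"
  shows "h x \<otimes>\<^bsub>H\<^esub> v \<otimes>\<^bsub>H\<^esub> inv\<^bsub>H\<^esub> h x \<in> h ` U"
proof -
  interpret h: group_hom G H h by fact
  obtain u where u: "u \<in> U" "v = h u" using assms(5) by blast
  then have "u \<in> carrier G" using assms(2) subgroup.subset by blast
  then have "h (x \<otimes>\<^bsub>G\<^esub> u \<otimes>\<^bsub>G\<^esub> inv\<^bsub>G\<^esub> x) = h x \<otimes>\<^bsub>H\<^esub> v \<otimes>\<^bsub>H\<^esub> inv\<^bsub>H\<^esub> h x"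
    using assms(3) u by simp
  then show ?thesis
    using assms(4) u by (metis imageI)
qed

lemma (in group_hom) subgroup_vimage:
  assumes "subgroup V H"
  shows "subgroup {x \<in> carrier G. h x \<in> V} G"
  using assms by (auto intro!: G.subgroupI exI[of _ "\<one>"]
      simp: subgroup.one_closed subgroup.m_closed subgroup.m_inv_closed)

text \<open>\<open>normalizer\<close> is a stabilizer, so it asks for equality of \<open>H\<close>
  with its conjugate. Conjugation is injective, and on a finite subgroup inclusion therefore
  suffices.\<close>

lemma (in group) mem_normalizer_iff:
  assumes "finite (carrier G)" "subgroup H G"
  shows "x \<in> normalizer G H \<longleftrightarrow> x \<in> carrier G \<and> (\<forall>h\<in>H. x \<otimes> h \<otimes> inv x \<in> H)"
proof -
  have sub: "H \<subseteq> carrier G" by (rule subgroup.subset[OF assms(2)])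
  have conj: "x <# H #> inv x = (\<lambda>h. x \<otimes> h \<otimes> inv x) ` H" for x
    by (auto simp: l_coset_def r_coset_def)
  have "(\<lambda>h. x \<otimes> h \<otimes> inv x) ` H = H"
    if x: "x \<in> carrier G" and "\<forall>h\<in>H. x \<otimes> h \<otimes> inv x \<in> H" for x
  proof (rule endo_inj_surj)
    show "finite H" using finite_subset[OF sub assms(1)] .
    show "(\<lambda>h. x \<otimes> h \<otimes> inv x) ` H \<subseteq> H" using that by blast
    show "inj_on (\<lambda>h. x \<otimes> h \<otimes> inv x) H"
      using sub x by (auto intro!: inj_onI simp: subsetD)
  qed
  then show ?thesis
    using sub unfolding normalizer_def stabilizer_def by (auto simp: conj)
qed

lemma (in group) conjugation_group_hom:
  assumes x: "x \<in> carrier G"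
  shows "group_hom G G (\<lambda>y. x \<otimes> y \<otimes> inv x)"
proof -
  have "x \<otimes> (a \<otimes> b) \<otimes> inv x = (x \<otimes> a \<otimes> inv x) \<otimes> (x \<otimes> b \<otimes> inv x)"
    if a: "a \<in> carrier G" and b: "b \<in> carrier G" for a b
  proof -
    have "inv x \<otimes> (x \<otimes> (b \<otimes> inv x)) = b \<otimes> inv x"
      using x b by (simp add: m_assoc[symmetric])
    then show ?thesis
      using x a b by (simp add: m_assoc)
  qed
  then show ?thesis
    using x unfolding group_hom_def group_hom_axioms_def by (simp add: group_axioms homI)
qed

lemma (in group) conjugation_inv:
  assumes x: "x \<in> carrier G" and y: "y \<in> carrier G"
  shows "x \<otimes> (inv x \<otimes> y \<otimes> inv (inv x)) \<otimes> inv x = y"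
    and "inv x \<otimes> (x \<otimes> y \<otimes> inv x) \<otimes> inv (inv x) = y"
proof -
  have "x \<otimes> (inv x \<otimes> z) = z" "inv x \<otimes> (x \<otimes> z) = z" if "z \<in> carrier G" for z
    using x that by (simp_all add: m_assoc[symmetric])
  then show "x \<otimes> (inv x \<otimes> y \<otimes> inv (inv x)) \<otimes> inv x = y"
    and "inv x \<otimes> (x \<otimes> y \<otimes> inv x) \<otimes> inv (inv x) = y"
    using x y by (simp_all add: m_assoc)
qed

lemma (in group) conjugation_image_inv:
  assumes "x \<in> carrier G" "L \<subseteq> carrier G"
  shows "(\<lambda>y. x \<otimes> y \<otimes> inv x) ` (\<lambda>y. inv x \<otimes> y \<otimes> inv (inv x)) ` L = L"
    and "(\<lambda>y. inv x \<otimes> y \<otimes> inv (inv x)) ` (\<lambda>y. x \<otimes> y \<otimes> inv x) ` L = L"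
  using conjugation_inv[OF assms(1)] subsetD[OF assms(2)] by (force simp: image_image)+

lemma (in group) conjugation_surj:
  assumes "x \<in> carrier G"
  shows "(\<lambda>y. x \<otimes> y \<otimes> inv x) ` carrier G = carrier G"
proof
  have "(\<lambda>y. inv x \<otimes> y \<otimes> inv (inv x)) ` carrier G \<subseteq> carrier G" using assms by auto
  then show "carrier G \<subseteq> (\<lambda>y. x \<otimes> y \<otimes> inv x) ` carrier G"
    using image_mono[of _ "carrier G" "\<lambda>y. x \<otimes> y \<otimes> inv x"]
      conjugation_image_inv(1)[OF assms order_refl] by metis
qed (use assms in auto)

lemma (in group) maximal_subgroup_conjugate:
  assumes x: "x \<in> carrier G" and M: "maximal_subgroup M G"
  shows "maximal_subgroup ((\<lambda>y. x \<otimes> y \<otimes> inv x) ` M) G"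
proof -
  let ?c = "\<lambda>y. x \<otimes> y \<otimes> inv x" and ?d = "\<lambda>y. inv x \<otimes> y \<otimes> inv (inv x)"
  have xi: "inv x \<in> carrier G" using x by simp
  have sM: "subgroup M G" "M \<noteq> carrier G"
    and mM: "\<And>L. subgroup L G \<Longrightarrow> M \<subseteq> L \<Longrightarrow> L = M \<or> L = carrier G"
    using M by (auto simp: maximal_subgroup_def)
  note dc = conjugation_image_inv(2)[OF x] and cd = conjugation_image_inv(1)[OF x]
  show ?thesis
    unfolding maximal_subgroup_def
  proof (intro conjI allI impI)
    show "subgroup (?c ` M) G"
      by (rule group_hom.subgroup_img_is_subgroup[OF conjugation_group_hom[OF x] sM(1)])
    show "?c ` M \<noteq> carrier G"
      using sM(2) dc[OF subgroup.subset[OF sM(1)]] conjugation_surj[OF xi] by metis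
    fix L assume L: "subgroup L G" "?c ` M \<subseteq> L"
    have "M \<subseteq> ?d ` L"
      using image_mono[OF L(2), of ?d] unfolding dc[OF subgroup.subset[OF sM(1)]] .
    then have "?d ` L = M \<or> ?d ` L = carrier G"
      by (rule mM[OF group_hom.subgroup_img_is_subgroup[OF conjugation_group_hom[OF xi] L(1)]])
    then show "L = ?c ` M \<or> L = carrier G"
      using cd[OF subgroup.subset[OF L(1)]] conjugation_surj[OF x] by metis
  qed
qed

text \<open>Conjugation permutes the maximal subgroups, so it preserves their intersection.\<close>

lemma (in group) frattini_normal: "frattini G \<lhd> G"
proof (rule normal_invI)
  \<comment> \<open>Adjoining the carrier keeps the family nonempty even if there are no maximal
    subgroups.\<close>
  have "frattini G = \<Inter>(insert (carrier G) {M. maximal_subgroup M G})"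
    by (simp add: frattini_def)
  then show "subgroup (frattini G) G"
    using subgroups_Inter[of "insert (carrier G) {M. maximal_subgroup M G}"] subgroup_self
    by (auto simp: maximal_subgroup_def)
  fix x y assume x: "x \<in> carrier G" and y: "y \<in> frattini G"
  have yc: "y \<in> carrier G" using y by (simp add: frattini_def)
  have "x \<otimes> y \<otimes> inv x \<in> M" if M: "maximal_subgroup M G" for M
  proof -
    have "maximal_subgroup ((\<lambda>y. inv x \<otimes> y \<otimes> inv (inv x)) ` M) G"
      by (rule maximal_subgroup_conjugate[OF _ M]) (use x in simp)
    then have "y \<in> (\<lambda>y. inv x \<otimes> y \<otimes> inv (inv x)) ` M" using y by (simp add: frattini_def)
    then have "x \<otimes> y \<otimes> inv x \<in> (\<lambda>y. x \<otimes> y \<otimes> inv x) ` (\<lambda>y. inv x \<otimes> y \<otimes> inv (inv x)) ` M"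
      by (rule imageI)
    moreover have "M \<subseteq> carrier G" using M subgroup.subset by (auto simp: maximal_subgroup_def)
    ultimately show ?thesis using conjugation_image_inv(1)[OF x] by simp
  qed
  then show "x \<otimes> y \<otimes> inv x \<in> frattini G" using x yc by (simp add: frattini_def)
qed

text \<open>Cauchy's theorem. Sylow's theorem with exponent 1 gives a subgroup of order
  \<open>p\<close>, and each of its nontrivial elements has order \<open>p\<close>.\<close>

lemma (in group) exists_ord_eq_prime:
  assumes "finite (carrier G)" "Factorial_Ring.prime p" "p dvd order G"
  shows "\<exists>y\<in>carrier G. ord y = p"
proof -
  obtain m where "order G = p ^ 1 * m" using assms(3) by auto
  then obtain P where P: "subgroup P G" "card P = p"
    using sylow_thm[OF assms(2) group_axioms _ assms(1), of 1] by auto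
  have "P \<noteq> {\<one>}" using P(2) assms(2) by auto
  then obtain y where y: "y \<in> P" "y \<noteq> \<one>" using subgroup.one_closed[OF P(1)] by blast
  have yG: "y \<in> carrier G" using subgroup.mem_carrier[OF P(1) y(1)] .
  interpret P: group "G\<lparr>carrier := P\<rparr>" using subgroup_imp_group[OF P(1)] .
  have "y [^] p = \<one>"
    using P.pow_order_eq_1[of y] y(1) P(2) by (simp add: order_def nat_pow_consistent[symmetric])
  then have "ord y dvd p" using pow_eq_id yG by blast
  then have "ord y = p" using ord_eq_1[OF yG] y(2) assms(2) prime_nat_iff by blast
  then show ?thesis using yG by blast
qed

text \<open>Every element is a product \<open>m u\<close>; here \<open>u\<close> normalizes
  \<open>U\<close> because it lies in it, and \<open>m\<close> does so by assumption.\<close>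

lemma (in group) normal_supplement_normalized:
  assumes "M \<lhd> G" "subgroup U G"
    and "\<And>m u. m \<in> M \<Longrightarrow> u \<in> U \<Longrightarrow> m \<otimes> u \<otimes> inv m \<in> U"
    and gen: "\<And>g. g \<in> carrier G \<Longrightarrow> \<exists>m\<in>M. \<exists>u\<in>U. g = m \<otimes> u"
  shows "U \<lhd> G"
proof (rule normal_invI[OF assms(2)])
  fix g v assume "g \<in> carrier G" and v: "v \<in> U"
  then obtain m u where mu: "m \<in> M" "u \<in> U" "g = m \<otimes> u" using gen by blast
  have U: "y \<in> carrier G" if "y \<in> U" for y
    using subgroup.mem_carrier[OF assms(2) that] .
  have m: "m \<in> carrier G" using assms(1) mu normal_imp_subgroup subgroup.mem_carrier by metis
  have "g \<otimes> v \<otimes> inv g = m \<otimes> (u \<otimes> v \<otimes> inv u) \<otimes> inv m"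
    using m U[OF v] U[OF mu(2)] mu(3) by (simp add: m_assoc inv_mult_group)
  moreover have "u \<otimes> v \<otimes> inv u \<in> U"
    using mu v assms(2) by (simp add: subgroup.m_closed subgroup.m_inv_closed)
  ultimately show "g \<otimes> v \<otimes> inv g \<in> U" using assms(3) mu by simp
qed

section \<open>Closure properties of a hereditary saturated formation, for groups of any
  type\<close>

locale hs_formation =
  fixes \<FF> :: group_class
  assumes nonempty: "\<FF> \<noteq> {}" and formation: "formation \<FF>"
    and hereditary: "hereditary \<FF>" and saturated: "saturated \<FF>"
begin

lemma group_class: "group_class \<FF>"
  using formation by (simp add: formation_def)

text \<open>The definition of a formation speaks only of quotients of groups on \<open>nat\<close>.
  The copy \<open>K\<close> of \<open>G\<close> also maps onto \<open>H\<close>, so \<open>H\<close>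
  is isomorphic to a quotient of \<open>K\<close>.\<close>

lemma in_class_epi:
  assumes "in_class G \<FF>" "group H" "h \<in> hom G H" "h ` carrier G = carrier H"
  shows "in_class H \<FF>"
proof -
  obtain K where K: "K \<in> \<FF>" "G \<cong> K" and G: "group G"
    using assms(1) by (auto simp: in_class_def)
  then have "group K" using group_class by (simp add: group_class_def)
  obtain f where f: "f \<in> iso K G" using group.iso_sym[OF G K(2)] by (auto simp: is_iso_def)
  interpret hf: group_hom K H "h \<circ> f"
    using hom_compose[OF _ assms(3), of f K] f assms(2) \<open>group K\<close>
    by (simp add: group_hom_def group_hom_axioms_def iso_def)
  have "(h \<circ> f) ` carrier K = carrier H"
  proof -
    have "f ` carrier K = carrier G" using f by (simp add: iso_def bij_betw_def)
    then show ?thesis using assms(4) by (simp only: image_comp[symmetric])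
  qed
  then have "K Mod kernel K H (h \<circ> f) \<cong> H" by (rule hf.FactGroup_iso)
  moreover have "in_class (K Mod kernel K H (h \<circ> f)) \<FF>"
    using formation K(1) hf.normal_kernel by (simp add: formation_def)
  ultimately show ?thesis using in_class_iso assms(2) by blast
qed

lemma in_class_image:
  assumes "group_hom G H h" "subgroup U G" "in_class (G\<lparr>carrier := U\<rparr>) \<FF>"
  shows "in_class (H\<lparr>carrier := h ` U\<rparr>) \<FF>"
proof -
  interpret group_hom "G\<lparr>carrier := U\<rparr>" "H\<lparr>carrier := h ` U\<rparr>" h
    using group_hom.induced_group_hom[OF assms(1,2)] .
  show ?thesis using in_class_epi[OF assms(3) H.group_axioms homh] by simp
qed

text \<open>Heredity too is stated on \<open>nat\<close> only: \<open>V\<close> is carried to the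
  copy \<open>K\<close>, and the inverse isomorphism brings the result back.\<close>

lemma in_class_subgroup:
  assumes "in_class G \<FF>" "subgroup V G"
  shows "in_class (G\<lparr>carrier := V\<rparr>) \<FF>"
proof -
  obtain K where K: "K \<in> \<FF>" "G \<cong> K" and G: "group G"
    using assms(1) by (auto simp: in_class_def)
  then have "group K" using group_class by (simp add: group_class_def)
  obtain f where f: "f \<in> iso G K" using K(2) by (auto simp: is_iso_def)
  let ?g = "inv_into (carrier G) f"
  have g: "?g \<in> iso K G" using group.iso_set_sym[OF G f] .
  have sub: "subgroup (f ` V) K"
    using subgroup.iso_subgroup[OF assms(2) G \<open>group K\<close> f] .
  have "in_class (G\<lparr>carrier := ?g ` f ` V\<rparr>) \<FF>"
  proof (rule in_class_image[OF _ sub])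
    show "group_hom K G ?g"
      using g G \<open>group K\<close> by (simp add: group_hom_def group_hom_axioms_def iso_def)
    show "in_class (K\<lparr>carrier := f ` V\<rparr>) \<FF>"
      using sub hereditary K(1) by (simp add: hereditary_def)
  qed
  moreover have "?g ` f ` V = V"
    using f subgroup.subset[OF assms(2)] by (simp add: iso_def bij_betw_def inv_into_image_cancel)
  ultimately show ?thesis by simp
qed

lemma in_class_subgroup_mono:
  assumes "group G" "subgroup U G" "in_class (G\<lparr>carrier := U\<rparr>) \<FF>" "subgroup V G" "V \<subseteq> U"
  shows "in_class (G\<lparr>carrier := V\<rparr>) \<FF>"
  using in_class_subgroup[OF assms(3) group.subgroup_incl[OF assms(1,4,2,5)]] by simp

text \<open>The class has a member, and the constant map sends it onto the trivial group.\<close>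

lemma in_class_trivial:
  assumes "group G"
  shows "in_class (G\<lparr>carrier := {\<one>\<^bsub>G\<^esub>}\<rparr>) \<FF>"
proof -
  obtain K where K: "K \<in> \<FF>" using nonempty by blast
  then have "in_class K \<FF>" using in_class_nat_iff group_class by blast
  moreover have "subgroup {\<one>\<^bsub>G\<^esub>} G" using group.triv_subgroup assms by blast
  moreover have "carrier K \<noteq> {}" using K group_class group.is_monoid monoid.one_closed unfolding group_class_def by fast
  ultimately show ?thesis
    using assms subgroup.subgroup_is_group
    by (intro in_class_epi[of K _ "\<lambda>_. \<one>\<^bsub>G\<^esub>"]) (auto simp: hom_def group.is_monoid)
qed

text \<open>The last assumption expresses, without reference to the Frattini subgroup, that the kernel
  of \<open>h\<close> is contained in it.\<close>

lemma in_class_frattini_extension: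
  assumes "group G" "finite (carrier G)" "in_class H \<FF>" "h \<in> hom G H" "h ` carrier G = carrier H"
    and nosup: "\<And>V. subgroup V G \<Longrightarrow> h ` V = carrier H \<Longrightarrow> V = carrier G"
  shows "in_class G \<FF>"
proof -
  obtain K :: "nat monoid" where K: "group K" "finite (carrier K)" "G \<cong> K"
    using finite_group_nat_copy assms by blast
  then have KG: "K \<cong> G" using assms group.iso_sym by blast
  then obtain f where f: "f \<in> iso K G" by (auto simp: is_iso_def)
  have H: "group H" using assms by (simp add: in_class_def)
  interpret f: group_hom K G f
    using f assms K by (simp add: group_hom_def group_hom_axioms_def iso_def)
  interpret k: group_hom K H "h \<circ> f"
    using hom_compose[OF f.homh assms(4)] K H by (simp add: group_hom_def group_hom_axioms_def)
  have fim: "f ` carrier K = carrier G" and finj: "inj_on f (carrier K)"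
    using f by (auto simp: iso_def bij_betw_def)
  have kim: "(h \<circ> f) ` carrier K = carrier H"
    using fim assms(5) by (metis image_comp)
  have nosup': "V = carrier K" if V: "subgroup V K" "(h \<circ> f) ` V = carrier H" for V
  proof -
    have "f ` V = carrier G"
      using nosup[OF f.subgroup_img_is_subgroup[OF V(1)]] V(2) by (metis image_comp)
    then show ?thesis
      using fim finj subgroup.subset[OF V(1)] inj_on_image_eq_iff by (metis order_refl)
  qed
  have ker: "kernel K H (h \<circ> f) \<subseteq> frattini K"
  proof
    fix x assume x: "x \<in> kernel K H (h \<circ> f)"
    then have xc: "x \<in> carrier K" by (simp add: kernel_def)
    have "x \<in> M" if M: "maximal_subgroup M K" for M
    proof -
      \<comment> \<open>By maximality \<open>?N\<close> is \<open>M\<close> or the whole group. In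
        the second case \<open>M\<close> alone maps onto \<open>H\<close>, against
        \<open>nosup'\<close>. So \<open>?N = M\<close>, and \<open>M\<close> contains the
        kernel.\<close>
      let ?N = "kernel K H (h \<circ> f) <#>\<^bsub>K\<^esub> M"
      have sM: "subgroup M K" and neM: "M \<noteq> carrier K"
        using M by (auto simp: maximal_subgroup_def)
      have sN: "subgroup ?N K" using k.normal_kernel sM by (rule f.G.mult_norm_subgroup)
      have MN: "M \<subseteq> ?N"
      proof
        fix m assume m: "m \<in> M"
        have "\<one>\<^bsub>K\<^esub> \<in> kernel K H (h \<circ> f)" using k.subgroup_kernel by (rule subgroup.one_closed)
        then show "m \<in> ?N"
          using m f.G.l_one[OF subgroup.mem_carrier[OF sM m]] unfolding set_mult_def by blast
      qed
      have xN: "x \<in> ?N"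
        using x xc subgroup.one_closed[OF sM] f.G.r_one[OF xc] unfolding set_mult_def by blast
      have "?N \<noteq> carrier K"
      proof
        assume N: "?N = carrier K"
        have "(h \<circ> f) ` M = carrier H"
        proof
          show "(h \<circ> f) ` M \<subseteq> carrier H" using kim subgroup.subset[OF sM] by blast
          show "carrier H \<subseteq> (h \<circ> f) ` M"
          proof
            fix y assume "y \<in> carrier H"
            then obtain z where z: "z \<in> carrier K" "y = (h \<circ> f) z" using kim by blast
            then obtain a m where am: "a \<in> kernel K H (h \<circ> f)" "m \<in> M" "z = a \<otimes>\<^bsub>K\<^esub> m"
              using z(1)[folded N] by (auto simp: set_mult_def)
            then have "(h \<circ> f) z = (h \<circ> f) m"
              using subgroup.mem_carrier[OF sM, of m] k.hom_mult[of a m] k.hom_closed[of m] k.H.l_one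
              unfolding kernel_def by simp
            then show "y \<in> (h \<circ> f) ` M" using am z by blast
          qed
        qed
        then show False using nosup' sM neM by blast
      qed
      then have "?N = M" using M sN MN by (auto simp: maximal_subgroup_def)
      then show ?thesis using xN by simp
    qed
    then show "x \<in> frattini K" using xc by (simp add: frattini_def)
  qed
  have fr: "frattini K \<lhd> K" by (rule f.G.frattini_normal)
  then have fr_sub: "subgroup (frattini K) K" by (rule normal_imp_subgroup)
  \<comment> \<open>Since the kernel lies in the Frattini subgroup, the Frattini quotient is an
    image of \<open>H\<close> and so belongs to the class; saturation then applies.\<close>
  have "\<exists>g\<in>hom H (K Mod frattini K). g ` carrier H = carrier (K Mod frattini K)"
  proof (rule hom_factor[OF K(1) k.homh kim H])
    show "group (K Mod frattini K)" using fr normal.factorgroup_is_group by blast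
    show "(\<lambda>a. frattini K #>\<^bsub>K\<^esub> a) \<in> hom K (K Mod frattini K)"
      using fr normal.r_coset_hom_Mod by blast
    show "(\<lambda>a. frattini K #>\<^bsub>K\<^esub> a) ` carrier K = carrier (K Mod frattini K)"
      by (simp add: carrier_FactGroup)
    show "frattini K #>\<^bsub>K\<^esub> x = \<one>\<^bsub>K Mod frattini K\<^esub>"
      if "x \<in> carrier K" "(h \<circ> f) x = \<one>\<^bsub>H\<^esub>" for x
      using that ker fr_sub f.G.coset_join2 by (auto simp: kernel_def subset_iff)
  qed
  then have "in_class (K Mod frattini K) \<FF>"
    using in_class_epi[OF assms(3) normal.factorgroup_is_group[OF fr]] by blast
  then have "in_class K \<FF>" using saturated K by (simp add: saturated_def)
  then show ?thesis using in_class_iso assms(1) KG by blast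
qed


section \<open>Lifting \<FF>-maximal subgroups, and \<open>NI\<close> under epimorphisms\<close>

lemma class_maximal_exists:
  assumes "finite (carrier G)" "subgroup V G" "in_class (G\<lparr>carrier := V\<rparr>) \<FF>"
  shows "\<exists>U. class_maximal \<FF> U G \<and> V \<subseteq> U"
proof -
  let ?S = "{U. subgroup U G \<and> V \<subseteq> U \<and> in_class (G\<lparr>carrier := U\<rparr>) \<FF>}"
  have "finite ?S"
    by (rule finite_subset[of _ "Pow (carrier G)"]) (auto simp: assms(1) dest: subgroup.subset)
  moreover have "V \<in> ?S" using assms by simp
  ultimately obtain U where U: "U \<in> ?S" "\<And>W. W \<in> ?S \<Longrightarrow> U \<subseteq> W \<Longrightarrow> U = W"
    using finite_has_maximal2[of ?S V] by auto
  then have "class_maximal \<FF> U G" unfolding class_maximal_def by auto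
  then show ?thesis using U by blast
qed

text \<open>A supplement of the kernel, minimal among those mapping onto \<open>L\<close>, meets the kernel in its
  Frattini subgroup, so saturation puts it into the class.\<close>

lemma class_maximal_lift:
  assumes "group_hom G H h" "finite (carrier G)" "h ` carrier G = carrier H" "class_maximal \<FF> L H"
  shows "\<exists>U. class_maximal \<FF> U G \<and> h ` U = L"
proof -
  interpret group_hom G H h by fact
  have L: "subgroup L H" "in_class (H\<lparr>carrier := L\<rparr>) \<FF>"
    and Lmax: "\<And>K. subgroup K H \<Longrightarrow> L \<subseteq> K \<Longrightarrow> in_class (H\<lparr>carrier := K\<rparr>) \<FF> \<Longrightarrow> L = K"
    using assms(4) by (auto simp: class_maximal_def)
  let ?S = "{V. subgroup V G \<and> h ` V = L}"
  have "finite ?S"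
    by (rule finite_subset[of _ "Pow (carrier G)"]) (auto simp: assms(2) dest: subgroup.subset)
  \<comment> \<open>The full preimage of \<open>L\<close> shows that the family is nonempty.\<close>
  moreover have "{x \<in> carrier G. h x \<in> L} \<in> ?S"
    using subgroup_vimage[OF L(1)] subgroup.subset[OF L(1)] assms(3) by auto
  ultimately obtain V where V: "V \<in> ?S" "\<And>W. W \<in> ?S \<Longrightarrow> W \<subseteq> V \<Longrightarrow> V = W"
    using finite_has_minimal2[of ?S] by (metis (no_types, lifting))
  then have sV: "subgroup V G" and hV: "h ` V = L" by auto
  have VG: "group (G\<lparr>carrier := V\<rparr>)" using sV by (rule G.subgroup_imp_group)
  have "in_class (G\<lparr>carrier := V\<rparr>) \<FF>"
  proof (rule in_class_frattini_extension[OF VG _ L(2)])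
    show "finite (carrier (G\<lparr>carrier := V\<rparr>))"
      using assms(2) subgroup.subset[OF sV] finite_subset by auto
    show "h \<in> hom (G\<lparr>carrier := V\<rparr>) (H\<lparr>carrier := L\<rparr>)"
      using induced_group_hom[OF sV] hV by (simp add: group_hom_def group_hom_axioms_def)
    show "h ` carrier (G\<lparr>carrier := V\<rparr>) = carrier (H\<lparr>carrier := L\<rparr>)" using hV by simp
    fix W assume W: "subgroup W (G\<lparr>carrier := V\<rparr>)" "h ` W = carrier (H\<lparr>carrier := L\<rparr>)"
    then have "subgroup W G" using G.incl_subgroup[OF sV] by blast
    moreover have "W \<subseteq> V" using subgroup.subset[OF W(1)] by simp
    ultimately show "W = carrier (G\<lparr>carrier := V\<rparr>)" using V(2)[of W] W(2) by simp
  qed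
  then obtain U where U: "class_maximal \<FF> U G" "V \<subseteq> U"
    using class_maximal_exists assms(2) sV by blast
  then have sU: "subgroup U G" and cU: "in_class (G\<lparr>carrier := U\<rparr>) \<FF>"
    by (auto simp: class_maximal_def)
  have "L = h ` U"
    using Lmax subgroup_img_is_subgroup[OF sU] in_class_image[OF assms(1) sU cU] U(2) hV by blast
  then show ?thesis using U(1) by blast
qed

lemma mem_NI_iff:
  assumes "group G" "finite (carrier G)"
  shows "x \<in> NI \<FF> G \<longleftrightarrow> x \<in> carrier G \<and>
    (\<forall>U. class_maximal \<FF> U G \<longrightarrow> (\<forall>u\<in>U. x \<otimes>\<^bsub>G\<^esub> u \<otimes>\<^bsub>G\<^esub> inv\<^bsub>G\<^esub> x \<in> U))"
  using group.mem_normalizer_iff[OF assms] by (auto simp: NI_def class_maximal_def)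

text \<open>Each \<FF>-maximal subgroup of \<open>H\<close> is the image of one of \<open>G\<close>.
  That one is normalized by \<open>x\<close>, so its image is normalized by
  \<open>h x\<close>.\<close>

lemma NI_image:
  assumes "group_hom G H h" "finite (carrier G)" "h ` carrier G = carrier H" "x \<in> NI \<FF> G"
  shows "h x \<in> NI \<FF> H"
proof -
  interpret group_hom G H h by fact
  have finH: "finite (carrier H)" using assms(2,3) by (metis finite_imageI)
  have x: "x \<in> carrier G" using assms(4) by (simp add: NI_def)
  have "h x \<otimes>\<^bsub>H\<^esub> v \<otimes>\<^bsub>H\<^esub> inv\<^bsub>H\<^esub> h x \<in> L" if L: "class_maximal \<FF> L H" "v \<in> L" for L v
  proof -
    obtain U where U: "class_maximal \<FF> U G" "h ` U = L"
      using class_maximal_lift[OF assms(1-3) L(1)] by blast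
    show ?thesis
      using hom_conj_closed_image[OF assms(1) _ x, of U v] U L(2) assms(2,4) mem_NI_iff[OF G.group_axioms]
      by (simp add: class_maximal_def)
  qed
  then show ?thesis using x finH mem_NI_iff[OF H.group_axioms] by simp
qed

section \<open>The \<pi>-elements of a group\<close>

text \<open>Some member of the class has order divisible by \<open>p\<close>. By Cauchy's theorem
  and heredity the class contains a cyclic group of order \<open>p\<close>, hence all of
  them.\<close>

lemma in_class_generate_prime_order:
  assumes "group G" "x \<in> carrier G" "p \<in> class_primes \<FF>" "group.ord G x = p"
  shows "in_class (G\<lparr>carrier := generate G {x}\<rparr>) \<FF>"
proof -
  interpret G: group G by fact
  obtain K where K: "K \<in> \<FF>" "Factorial_Ring.prime p" "p dvd order K"
    using assms(3) by (auto simp: class_primes_def prime_divs_def)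
  have gK: "group K" "finite (carrier K)" using K(1) group_class by (auto simp: group_class_def)
  interpret K: group K by fact
  obtain y where yK: "y \<in> carrier K" and oy: "K.ord y = p"
    using K.exists_ord_eq_prime[OF gK(2) K(2,3)] by blast
  have sK: "subgroup (generate K {y}) K" and sG: "subgroup (generate G {x}) G"
    using K.generate_is_subgroup G.generate_is_subgroup yK assms(2) by auto
  let ?A = "K\<lparr>carrier := generate K {y}\<rparr>" and ?B = "G\<lparr>carrier := generate G {x}\<rparr>"
  have "\<exists>f\<in>hom ?A ?B. f ` carrier ?A = carrier ?B"
  \<comment> \<open>Both cyclic groups are images of the integers, and in both cases the kernel
    consists of the multiples of \<open>p\<close>.\<close>
  proof (rule hom_factor[of integer_group "\<lambda>i. y [^]\<^bsub>K\<^esub> (i::int)" _ _ "\<lambda>i. x [^]\<^bsub>G\<^esub> (i::int)"])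
    show "(\<lambda>i. y [^]\<^bsub>K\<^esub> (i::int)) \<in> hom integer_group ?A"
      using K.generate_pow[OF yK] by (auto intro!: homI simp: K.int_pow_mult yK)
    show "(\<lambda>i. y [^]\<^bsub>K\<^esub> (i::int)) ` carrier integer_group = carrier ?A"
      using K.generate_pow[OF yK] by auto
    show "(\<lambda>i. x [^]\<^bsub>G\<^esub> (i::int)) \<in> hom integer_group ?B"
      using G.generate_pow[OF assms(2)] by (auto intro!: homI simp: G.int_pow_mult assms(2))
    show "(\<lambda>i. x [^]\<^bsub>G\<^esub> (i::int)) ` carrier integer_group = carrier ?B"
      using G.generate_pow[OF assms(2)] by auto
    show "x [^]\<^bsub>G\<^esub> i = \<one>\<^bsub>?B\<^esub>" if "y [^]\<^bsub>K\<^esub> i = \<one>\<^bsub>?A\<^esub>" for i :: int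
      using that G.int_pow_eq_id[OF assms(2)] K.int_pow_eq_id[OF yK] assms(4) oy by simp
  qed (use sK sG K.subgroup_imp_group G.subgroup_imp_group in auto)
  moreover have "in_class K \<FF>" using K(1) in_class_nat_iff group_class by blast
  ultimately show ?thesis
    using in_class_epi in_class_subgroup[OF _ sK] G.subgroup_imp_group[OF sG] by blast
qed

text \<open>These are the \<pi>-elements of \<open>G\<close>, where \<pi> is the set of primes of
  the class. In general they do not form a subgroup.\<close>

definition class_elements :: "('a, 'b) monoid_scheme \<Rightarrow> 'a set" where
  "class_elements G = {x \<in> carrier G. \<forall>p. Factorial_Ring.prime p \<longrightarrow> p dvd group.ord G x \<longrightarrow> p \<in> class_primes \<FF>}"

text \<open>The order of the image of an element divides the order of the element.\<close>

lemma class_elements_image: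
  assumes "group_hom G H h" "x \<in> class_elements G"
  shows "h x \<in> class_elements H"
proof -
  interpret group_hom G H h by fact
  have x: "x \<in> carrier G" using assms(2) by (simp add: class_elements_def)
  have "h x [^]\<^bsub>H\<^esub> G.ord x = h (x [^]\<^bsub>G\<^esub> G.ord x)"
    by (rule hom_nat_pow[OF x, symmetric])
  also have "\<dots> = \<one>\<^bsub>H\<^esub>" using x by simp
  finally have "H.ord (h x) dvd G.ord x" by (simp only: H.pow_eq_id[OF hom_closed[OF x]])
  then show ?thesis
    using assms(2) x dvd_trans[of _ "H.ord (h x)" "G.ord x"] unfolding class_elements_def by simp
qed

lemma class_elements_subgroup:
  assumes "group G" "subgroup U G"
  shows "class_elements (G\<lparr>carrier := U\<rparr>) = U \<inter> class_elements G"
proof -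
  interpret G: group G by fact
  interpret U: group "G\<lparr>carrier := U\<rparr>" using G.subgroup_imp_group[OF assms(2)] .
  have "U.ord x = G.ord x" for x
    unfolding U.ord_def G.ord_def by (simp add: G.nat_pow_consistent[symmetric])
  then show ?thesis
    using subgroup.subset[OF assms(2)] by (auto simp: class_elements_def)
qed

text \<open>By Lagrange the order of an element divides the order of \<open>U\<close>, which is the
  order of a member of the class.\<close>

lemma in_class_subset_class_elements:
  assumes "group G" "subgroup U G" "in_class (G\<lparr>carrier := U\<rparr>) \<FF>"
  shows "U \<subseteq> class_elements G"
proof
  fix x assume x: "x \<in> U"
  interpret G: group G by fact
  interpret U: group "G\<lparr>carrier := U\<rparr>" using G.subgroup_imp_group[OF assms(2)] .
  obtain K where K: "K \<in> \<FF>" "G\<lparr>carrier := U\<rparr> \<cong> K" using assms(3) by (auto simp: in_class_def)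
  have "x \<in> carrier G" using subgroup.mem_carrier[OF assms(2) x] .
  have "x [^]\<^bsub>G\<^esub> order (G\<lparr>carrier := U\<rparr>) = \<one>\<^bsub>G\<^esub>"
    using U.pow_order_eq_1[of x] x by (simp add: G.nat_pow_consistent[symmetric])
  then have "G.ord x dvd order (G\<lparr>carrier := U\<rparr>)" using G.pow_eq_id \<open>x \<in> carrier G\<close> by blast
  also have "order (G\<lparr>carrier := U\<rparr>) = order K" using iso_same_order K(2) by (auto simp: is_iso_def)
  finally show "x \<in> class_elements G"
    using K(1) \<open>x \<in> carrier G\<close>
      dvd_trans[of _ "G.ord x" "order K"]
    unfolding class_elements_def class_primes_def prime_divs_def by auto
qed

text \<open>A nontrivial \<pi>-element \<open>x\<close> has a power of prime order \<open>p\<close>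
  in \<pi>, namely with exponent \<open>G.ord x div p\<close>. It generates a nontrivial subgroup in
  the class, against maximality of the trivial one.\<close>

lemma class_maximal_trivial_imp_class_elements_trivial:
  assumes "group G" "finite (carrier G)" "class_maximal \<FF> {\<one>\<^bsub>G\<^esub>} G"
  shows "class_elements G = {\<one>\<^bsub>G\<^esub>}"
proof -
  interpret G: group G by fact
  have "x = \<one>\<^bsub>G\<^esub>" if x: "x \<in> class_elements G" for x
  proof (rule ccontr)
    assume "x \<noteq> \<one>\<^bsub>G\<^esub>"
    have xG: "x \<in> carrier G" using x by (simp add: class_elements_def)
    then have "G.ord x \<noteq> 1" using G.ord_eq_1 \<open>x \<noteq> \<one>\<^bsub>G\<^esub>\<close> by blast
    then obtain p where p: "Factorial_Ring.prime p" "p dvd G.ord x" using prime_factor_nat by blast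
    let ?k = "G.ord x div p" and ?y = "x [^]\<^bsub>G\<^esub> (G.ord x div p)"
    have pos: "G.ord x > 0" using G.ord_ge_1[OF assms(2) xG] by simp
    have pk: "G.ord x = p * ?k" using p(2) by simp
    then have k: "?k \<noteq> 0" using pos by (metis mult_0_right less_irrefl)
    have y: "?y \<in> carrier G" using xG by simp
    have "gcd (G.ord x) ?k = ?k" using pk by (metis dvd_triv_right gcd_proj2_if_dvd_nat)
    then have "G.ord ?y = G.ord x div ?k" using G.ord_pow_gen[OF xG, of ?k] k by simp
    then have oy: "G.ord ?y = p" using pk k by (metis nonzero_mult_div_cancel_right)
    have sub: "subgroup (generate G {?y}) G" using G.generate_is_subgroup y by simp
    have "in_class (G\<lparr>carrier := generate G {?y}\<rparr>) \<FF>"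
      using in_class_generate_prime_order[OF assms(1) y _ oy] x p by (simp add: class_elements_def)
    then have "{\<one>\<^bsub>G\<^esub>} = generate G {?y}"
      using assms(3) sub subgroup.one_closed[OF sub] by (simp add: class_maximal_def)
    then have "?y = \<one>\<^bsub>G\<^esub>" using generate.incl[of ?y "{?y}" G] by blast
    then show False using oy p(1) G.ord_eq_1[OF y] not_prime_1 by metis
  qed
  then show ?thesis by (auto simp: class_elements_def)
qed


section \<open>The product \<open>HK\<close> lies in the class: induction on the order\<close>

text \<open>The situation \<open>G = KH\<close> of the induction, with every condition chosen to
  survive epimorphisms. Thus \<open>H\<close> only has to lie in the class, and \<open>K\<close>
  only has to be generated by \<pi>-elements.\<close>

definition NI_factorization :: "('a, 'b) monoid_scheme \<Rightarrow> 'a set \<Rightarrow> 'a set \<Rightarrow> bool" where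
  "NI_factorization G H K \<longleftrightarrow> group G \<and> finite (carrier G) \<and>
     subgroup H G \<and> in_class (G\<lparr>carrier := H\<rparr>) \<FF> \<and>
     K \<lhd> G \<and> K <#>\<^bsub>G\<^esub> H = carrier G \<and> K \<subseteq> NI \<FF> G \<and>
     (\<exists>S. S \<subseteq> class_elements G \<and> K = generate G S)"

lemma NI_factorization_image:
  assumes "NI_factorization G H K" "group_hom G G' h" "h ` carrier G = carrier G'"
  shows "NI_factorization G' (h ` H) (h ` K)"
proof -
  interpret group_hom G G' h by fact
  have fin: "finite (carrier G)" and H: "subgroup H G" and cH: "in_class (G\<lparr>carrier := H\<rparr>) \<FF>"
    and K: "K \<lhd> G" and KH: "K <#>\<^bsub>G\<^esub> H = carrier G" and NI: "K \<subseteq> NI \<FF> G"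
    using assms(1) by (auto simp: NI_factorization_def)
  obtain S where S: "S \<subseteq> class_elements G" "K = generate G S"
    using assms(1) by (auto simp: NI_factorization_def)
  have KG: "K \<subseteq> carrier G" using K normal_imp_subgroup subgroup.subset by blast
  have "h ` K <#>\<^bsub>G'\<^esub> h ` H = h ` (K <#>\<^bsub>G\<^esub> H)"
    using set_mult_hom[OF homh KG subgroup.subset[OF H]] by simp
  moreover have "h ` K \<lhd> G'"
    using normal.surj_hom_normal_subgroup[OF K assms(2,3)] .
  moreover have "h ` K = generate G' (h ` S)"
    using generate_img[of S] S by (auto simp: class_elements_def)
  moreover have "h ` S \<subseteq> class_elements G'"
    using class_elements_image[OF assms(2)] S(1) by blast
  moreover have "finite (carrier G')" using fin assms(3) by (metis finite_imageI)
  moreover have "h ` K \<subseteq> NI \<FF> G'"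
    using NI_image[OF assms(2) fin assms(3)] NI by blast
  ultimately show ?thesis
    using subgroup_img_is_subgroup[OF H] in_class_image[OF assms(2) H cH] KH assms(3) H.group_axioms
    unfolding NI_factorization_def by auto
qed

text \<open>A quotient has cosets as elements, so it is copied to \<open>nat\<close> before the
  induction hypothesis is applied. Its order is smaller because \<open>M\<close> is
  nontrivial.\<close>

lemma in_class_quotient_NI_factorization:
  fixes G :: "nat monoid"
  assumes "NI_factorization G H K" "M \<lhd> G" "M \<noteq> {\<one>\<^bsub>G\<^esub>}"
    and IH: "\<And>(G' :: nat monoid) H' K'. order G' < order G \<Longrightarrow> NI_factorization G' H' K' \<Longrightarrow> in_class G' \<FF>"
  shows "in_class (G Mod M) \<FF>"
proof -
  interpret M: normal M G by fact
  have fin: "finite (carrier G)" using assms(1) by (simp add: NI_factorization_def)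
  have gQ: "group (G Mod M)" by (rule M.factorgroup_is_group)
  have finQ: "finite (carrier (G Mod M))" using fin by (simp add: carrier_FactGroup)
  obtain G' :: "nat monoid" where G': "group G'" "finite (carrier G')" "G Mod M \<cong> G'"
    using finite_group_nat_copy[OF gQ finQ] by blast
  obtain f where f: "f \<in> iso (G Mod M) G'" using G'(3) by (auto simp: is_iso_def)
  let ?h = "f \<circ> (\<lambda>a. M #>\<^bsub>G\<^esub> a)"
  have hom: "group_hom G G' ?h"
    using hom_compose[OF M.r_coset_hom_Mod, of f G'] f G'(1)
    by (simp add: group_hom_def group_hom_axioms_def iso_def M.group_axioms)
  have "?h ` carrier G = f ` carrier (G Mod M)"
    by (simp add: carrier_FactGroup image_image)
  then have surj: "?h ` carrier G = carrier G'" using f by (simp add: iso_def bij_betw_def)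
  have "order G' = order (G Mod M)" using iso_same_order[OF f] by simp
  moreover have "order (G Mod M) * card M = order G"
    using M.lagrange[OF M.subgroup_axioms] by (simp add: order_def FactGroup_def)
  moreover have "card M > 1"
  proof -
    have "finite M" using fin M.subset finite_subset by blast
    moreover have "{\<one>\<^bsub>G\<^esub>} \<subset> M" using assms(3) subgroup.one_closed[OF M.subgroup_axioms] by blast
    ultimately show ?thesis using psubset_card_mono[of M "{\<one>\<^bsub>G\<^esub>}"] by simp
  qed
  moreover have "order G > 0" using fin M.order_gt_0_iff_finite by blast
  ultimately have "order G' < order G"
    by (metis mult.right_neutral mult_less_cancel1 mult_0 gr0I)
  then have "in_class G' \<FF>" using IH NI_factorization_image[OF assms(1) hom surj] by blast
  moreover have "G' \<cong> G Mod M" using group.iso_sym[OF gQ G'(3)] .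
  ultimately show ?thesis using in_class_iso gQ by blast
qed

text \<open>The induction needs a fixed type for all groups involved, hence \<open>nat\<close>;
  other types are reached afterwards by isomorphism.\<close>

lemma NI_factorization_in_class_nat:
  fixes G :: "nat monoid"
  assumes "NI_factorization G H K"
  shows "in_class G \<FF>"
  using assms
proof (induction "order G" arbitrary: G H K rule: less_induct)
  case less
  note NIf = less.prems
  have gG: "group G" and fin: "finite (carrier G)" and H: "subgroup H G"
    and cH: "in_class (G\<lparr>carrier := H\<rparr>) \<FF>"
    and K: "K \<lhd> G" and KH: "K <#>\<^bsub>G\<^esub> H = carrier G" and NI: "K \<subseteq> NI \<FF> G"
    using NIf by (auto simp: NI_factorization_def)
  obtain S where S: "S \<subseteq> class_elements G" "K = generate G S"
    using NIf by (auto simp: NI_factorization_def)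
  interpret group G by fact
  have quot: "in_class (G Mod M) \<FF>" if "M \<lhd> G" "M \<noteq> {\<one>\<^bsub>G\<^esub>}" for M
    using in_class_quotient_NI_factorization[OF NIf that] less.hyps by blast
  show ?case
  proof (cases "K = {\<one>\<^bsub>G\<^esub>}")
    case True
    have "K <#>\<^bsub>G\<^esub> H = H"
      using subgroup.mem_carrier[OF H] by (auto simp: True set_mult_def)
    then have "H = carrier G" using KH by simp
    then show ?thesis using cH by simp
  next
    case False
    let ?N = "{M. M \<lhd> G \<and> M \<noteq> {\<one>\<^bsub>G\<^esub>} \<and> M \<subseteq> K}"
    have "finite ?N"
      by (rule finite_subset[of _ "Pow (carrier G)"])
        (auto simp: fin dest!: normal_imp_subgroup subgroup.subset)
    moreover have "K \<in> ?N" using K False by simp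
    ultimately obtain M where M: "M \<in> ?N" "\<And>L. L \<in> ?N \<Longrightarrow> L \<subseteq> M \<Longrightarrow> M = L"
      using finite_has_minimal2[of ?N K] by auto
    then have nM: "M \<lhd> G" and M1: "M \<noteq> {\<one>\<^bsub>G\<^esub>}" and MK: "M \<subseteq> K" by auto
    interpret M: normal M G by fact
    interpret q: group_hom G "G Mod M" "\<lambda>a. M #>\<^bsub>G\<^esub> a"
      using M.r_coset_hom_Mod M.factorgroup_is_group
      by (simp add: group_hom_def group_hom_axioms_def group_axioms)
    \<comment> \<open>The quotient by \<open>M\<close> lies in the class, so it is its own
      \<FF>-maximal subgroup. Lifting it yields an \<FF>-maximal supplement \<open>U\<close> of
      \<open>M\<close>.\<close>
    have "class_maximal \<FF> (carrier (G Mod M)) (G Mod M)"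
      using quot[OF nM M1] q.H.subgroup_self subgroup.subset
      by (auto simp: class_maximal_def)
    then obtain U where U: "class_maximal \<FF> U G" "(\<lambda>a. M #>\<^bsub>G\<^esub> a) ` U = carrier (G Mod M)"
      using class_maximal_lift[OF q.group_hom_axioms fin carrier_FactGroup[symmetric]] by blast
    have sU: "subgroup U G" and cU: "in_class (G\<lparr>carrier := U\<rparr>) \<FF>"
      using U(1) by (auto simp: class_maximal_def)
    have gen: "\<exists>m\<in>M. \<exists>u\<in>U. g = m \<otimes>\<^bsub>G\<^esub> u" if g: "g \<in> carrier G" for g
    proof -
      have "M #>\<^bsub>G\<^esub> g \<in> (\<lambda>a. M #>\<^bsub>G\<^esub> a) ` U" using g U(2) by (simp add: carrier_FactGroup)
      then obtain u where u: "u \<in> U" "M #>\<^bsub>G\<^esub> g = M #>\<^bsub>G\<^esub> u" by blast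
      then have "g \<in> M #>\<^bsub>G\<^esub> u" using rcos_self[OF g M.subgroup_axioms] by simp
      then show ?thesis using u(1) by (auto simp: r_coset_def)
    qed
    have nU: "U \<lhd> G"
    proof (rule normal_supplement_normalized[OF nM sU _ gen])
      show "m \<otimes>\<^bsub>G\<^esub> u \<otimes>\<^bsub>G\<^esub> inv\<^bsub>G\<^esub> m \<in> U" if "m \<in> M" "u \<in> U" for m u
        using that MK NI U(1) mem_NI_iff[OF gG fin] by blast
    qed
    show ?thesis
    proof (cases "M \<subseteq> U")
      case True
      then have "carrier G \<subseteq> U" using gen subgroup.m_closed[OF sU] by blast
      then have "U = carrier G" using subgroup.subset[OF sU] by blast
      then show ?thesis using cU by simp
    next
      case False
      have "M \<inter> U \<lhd> G" using normal_subgroup_intersect[OF nM nU] .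
      then have MU: "M \<inter> U = {\<one>\<^bsub>G\<^esub>}" using M(2)[of "M \<inter> U"] MK False by blast
      show ?thesis
      proof (cases "U = {\<one>\<^bsub>G\<^esub>}")
        \<comment> \<open>If \<open>U\<close> is trivial, the identity is the only \<pi>-element, so
          the subgroup \<open>K\<close> they generate is trivial and cannot contain
          \<open>M\<close>.\<close>
        case True
        then have "class_elements G = {\<one>\<^bsub>G\<^esub>}"
          using class_maximal_trivial_imp_class_elements_trivial[OF gG fin] U(1) by simp
        then have "K \<subseteq> {\<one>\<^bsub>G\<^esub>}"
          using S generate_subgroup_incl[OF _ triv_subgroup] by simp
        then show ?thesis using MK M1 subgroup.one_closed[OF M.subgroup_axioms] by blast
      next
        case False
        \<comment> \<open>Both \<open>M\<close> and \<open>U\<close> are nontrivial normal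
          subgroups, so both quotients lie in the class by induction, and the kernels meet
          trivially.\<close>
        have "in_class (G Mod (M \<inter> U)) \<FF>"
          using formation quot[OF nM M1] quot[OF nU False] gG fin nM nU
          unfolding formation_def by blast
        then have "in_class (G Mod {\<one>\<^bsub>G\<^esub>}) \<FF>" using MU by simp
        then show ?thesis using trivial_factor_iso in_class_iso gG by (metis is_isoI)
      qed
    qed
  qed
qed

lemma NI_factorization_in_class:
  assumes "NI_factorization G H K"
  shows "in_class G \<FF>"
proof -
  have gG: "group G" and fin: "finite (carrier G)" using assms by (auto simp: NI_factorization_def)
  obtain G' :: "nat monoid" where G': "group G'" "G \<cong> G'"
    using finite_group_nat_copy[OF gG fin] by blast
  then obtain f where f: "f \<in> iso G G'" by (auto simp: is_iso_def)
  then have "group_hom G G' f" "f ` carrier G = carrier G'"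
    using gG G'(1) by (auto simp: group_hom_def group_hom_axioms_def iso_def bij_betw_def)
  then have "in_class G' \<FF>"
    using NI_factorization_in_class_nat NI_factorization_image[OF assms] by blast
  then show ?thesis using in_class_iso group.iso_sym[OF gG G'(2)] gG by blast
qed

section \<open>\<open>Int_class\<close> as the set of \<pi>-elements of \<open>NI\<close>\<close>

text \<open>Conjugation by \<open>g\<close> is an epimorphism of \<open>G\<close> onto itself, so
  the facts on images apply to it.\<close>

lemma NI_class_elements_conjugate:
  assumes "group G" "finite (carrier G)" "s \<in> NI \<FF> G \<inter> class_elements G" "g \<in> carrier G"
  shows "g \<otimes>\<^bsub>G\<^esub> s \<otimes>\<^bsub>G\<^esub> inv\<^bsub>G\<^esub> g \<in> NI \<FF> G \<inter> class_elements G"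
proof -
  note hom = group.conjugation_group_hom[OF assms(1,4)]
  show ?thesis
    using NI_image[OF hom assms(2) group.conjugation_surj[OF assms(1,4)]]
      class_elements_image[OF hom] assms(3) by blast
qed

text \<open>Let \<open>?K\<close> be generated by these elements. For each \<FF>-maximal
  \<open>U\<close> the product \<open>?X\<close> of \<open>?K\<close> and \<open>U\<close> lies in
  the class, so \<open>U = ?X\<close> by maximality and \<open>U\<close> contains
  \<open>?K\<close>.\<close>

lemma NI_class_elements_subset_Int:
  assumes "group G" "finite (carrier G)"
  shows "NI \<FF> G \<inter> class_elements G \<subseteq> Int_class \<FF> G"
proof -
  interpret group G by fact
  let ?S = "NI \<FF> G \<inter> class_elements G"
  let ?K = "generate G ?S"
  have Sc: "?S \<subseteq> carrier G" by (auto simp: NI_def)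
  have nK: "?K \<lhd> G" using normal_generateI[OF Sc] NI_class_elements_conjugate[OF assms] by blast
  have KNI: "?K \<subseteq> normalizer G U" if U: "class_maximal \<FF> U G" for U
  proof (rule generate_subgroup_incl)
    show "?S \<subseteq> normalizer G U" using U unfolding NI_def by blast
    show "subgroup (normalizer G U) G"
      using U by (intro normalizer_imp_subgroup subgroup.subset) (simp add: class_maximal_def)
  qed
  have "?K \<subseteq> U" if U: "class_maximal \<FF> U G" for U
  proof -
    have sU: "subgroup U G" and cU: "in_class (G\<lparr>carrier := U\<rparr>) \<FF>"
      using U by (auto simp: class_maximal_def)
    let ?X = "?K <#>\<^bsub>G\<^esub> U"
    have sX: "subgroup ?X G" using mult_norm_subgroup[OF nK sU] .
    interpret X: group "G\<lparr>carrier := ?X\<rparr>" using subgroup_imp_group[OF sX] .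
    have sK: "subgroup ?K G" using nK by (rule normal_imp_subgroup)
    have KX: "?K \<subseteq> ?X"
    proof
      fix x assume x: "x \<in> ?K"
      then show "x \<in> ?X"
        using r_one[OF subgroup.mem_carrier[OF sK x]] subgroup.one_closed[OF sU]
        unfolding set_mult_def by blast
    qed
    have UX: "U \<subseteq> ?X"
    proof
      fix x assume x: "x \<in> U"
      then show "x \<in> ?X"
        using l_one[OF subgroup.mem_carrier[OF sU x]] subgroup.one_closed[OF sK]
        unfolding set_mult_def by blast
    qed
    have finX: "finite ?X" using assms(2) subgroup.subset[OF sX] finite_subset by blast
    have "NI_factorization (G\<lparr>carrier := ?X\<rparr>) U ?K"
      unfolding NI_factorization_def
    proof (intro conjI exI[of _ ?S])
      show "subgroup U (G\<lparr>carrier := ?X\<rparr>)" using subgroup_incl[OF sU sX UX] .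
      show "?K \<lhd> G\<lparr>carrier := ?X\<rparr>" using normal_restrict_supergroup[OF sX nK KX] .
      \<comment> \<open>An \<FF>-maximal subgroup \<open>L\<close> of \<open>?X\<close> extends to
        an \<FF>-maximal \<open>W\<close> of \<open>G\<close>. By heredity
        \<open>L = W \<inter> ?X\<close>, and elements of \<open>?K\<close> normalize both
        \<open>W\<close> and \<open>?X\<close>.\<close>
      show "?K \<subseteq> NI \<FF> (G\<lparr>carrier := ?X\<rparr>)"
      proof
        fix x assume x: "x \<in> ?K"
        then have xX: "x \<in> ?X" using KX by blast
        have "x \<otimes>\<^bsub>G\<^esub> l \<otimes>\<^bsub>G\<^esub> inv\<^bsub>G\<^esub> x \<in> L"
          if L: "class_maximal \<FF> L (G\<lparr>carrier := ?X\<rparr>)" and l: "l \<in> L" for L l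
        proof -
          have sLX: "subgroup L (G\<lparr>carrier := ?X\<rparr>)" and cL: "in_class (G\<lparr>carrier := L\<rparr>) \<FF>"
            using L by (auto simp: class_maximal_def)
          have LX: "L \<subseteq> ?X" using subgroup.subset[OF sLX] by simp
          have sL: "subgroup L G" using incl_subgroup[OF sX sLX] .
          obtain W where W: "class_maximal \<FF> W G" "L \<subseteq> W"
            using class_maximal_exists[OF assms(2) sL cL] by blast
          have sW: "subgroup W G" and cW: "in_class (G\<lparr>carrier := W\<rparr>) \<FF>"
            using W(1) by (auto simp: class_maximal_def)
          have sWX: "subgroup (W \<inter> ?X) G" using subgroups_Inter_pair[OF sW sX] .
          have "in_class (G\<lparr>carrier := W \<inter> ?X\<rparr>) \<FF>"
            using in_class_subgroup_mono[OF assms(1) sW cW sWX] by simp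
          moreover have "subgroup (W \<inter> ?X) (G\<lparr>carrier := ?X\<rparr>)" using subgroup_incl[OF sWX sX] by simp
          ultimately have LW: "L = W \<inter> ?X" using L W(2) LX by (simp add: class_maximal_def)
          have "x \<otimes>\<^bsub>G\<^esub> l \<otimes>\<^bsub>G\<^esub> inv\<^bsub>G\<^esub> x \<in> W"
            using KNI[OF W(1)] x l W(2) mem_normalizer_iff[OF assms(2) sW] by blast
          moreover have "x \<otimes>\<^bsub>G\<^esub> l \<otimes>\<^bsub>G\<^esub> inv\<^bsub>G\<^esub> x \<in> ?X"
            using xX l LX sX by (meson subgroup.m_closed subgroup.m_inv_closed subsetD)
          ultimately show ?thesis using LW by simp
        qed
        then show "x \<in> NI \<FF> (G\<lparr>carrier := ?X\<rparr>)"
          using xX finX by (subst mem_NI_iff) (auto simp: X.group_axioms m_inv_consistent[OF sX])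
      qed
      show "?S \<subseteq> class_elements (G\<lparr>carrier := ?X\<rparr>)"
        unfolding class_elements_subgroup[OF assms(1) sX] using KX generate.incl[of _ ?S G] by blast
      show "?K = generate (G\<lparr>carrier := ?X\<rparr>) ?S"
        using generate_consistent[OF _ sX, of ?S] KX generate.incl[of _ ?S G] by blast
    qed (use finX cU X.group_axioms in simp_all)
    then have "in_class (G\<lparr>carrier := ?X\<rparr>) \<FF>" by (rule NI_factorization_in_class)
    then have "U = ?X" using U sX UX by (simp add: class_maximal_def)
    then show ?thesis using KX by simp
  qed
  then show ?thesis using Sc generate.incl[of _ ?S G] by (auto simp: Int_class_def)
qed

text \<open>For the inclusion from left to right, enlarging the trivial subgroup gives at least one
  \<FF>-maximal subgroup. The intersection lies in it and so consists of \<pi>-elements. It also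
  lies in every normalizer, since a subgroup normalizes itself.\<close>

lemma Int_class_eq:
  assumes "group G" "finite (carrier G)"
  shows "Int_class \<FF> G = NI \<FF> G \<inter> class_elements G"
proof
  interpret group G by fact
  have "subgroup {\<one>\<^bsub>G\<^esub>} G" by (rule triv_subgroup)
  then obtain U where U: "class_maximal \<FF> U G"
    using class_maximal_exists assms in_class_trivial by blast
  have "U \<subseteq> class_elements G"
    using U in_class_subset_class_elements[OF assms(1)] by (simp add: class_maximal_def)
  then have "Int_class \<FF> G \<subseteq> class_elements G" using U by (auto simp: Int_class_def)
  moreover have "Int_class \<FF> G \<subseteq> NI \<FF> G"
  proof
    fix x assume x: "x \<in> Int_class \<FF> G"
    have "x \<otimes>\<^bsub>G\<^esub> u \<otimes>\<^bsub>G\<^esub> inv\<^bsub>G\<^esub> x \<in> W" if "class_maximal \<FF> W G" "u \<in> W" for W u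
    proof -
      have "subgroup W G" "x \<in> W" using x that by (auto simp: class_maximal_def Int_class_def)
      then show ?thesis using that(2) by (meson subgroup.m_closed subgroup.m_inv_closed)
    qed
    then show "x \<in> NI \<FF> G" using x mem_NI_iff[OF assms] by (simp add: Int_class_def)
  qed
  ultimately show "Int_class \<FF> G \<subseteq> NI \<FF> G \<inter> class_elements G" by blast
qed (rule NI_class_elements_subset_Int[OF assms])


section \<open>The quotient of \<open>NI\<close> by \<open>Int_class\<close>, and the
  residual\<close>

lemma subgroup_NI:
  assumes "group G"
  shows "subgroup (NI \<FF> G) G"
proof -
  interpret group G by fact
  have "subgroup (\<Inter>(insert (carrier G) (normalizer G ` {H. class_maximal \<FF> H G}))) G"
  proof (rule subgroups_Inter)
    fix H assume "H \<in> insert (carrier G) (normalizer G ` {H. class_maximal \<FF> H G})"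
    then show "subgroup H G"
      using subgroup_self by (auto simp: class_maximal_def intro!: normalizer_imp_subgroup subgroup.subset)
  qed simp
  then show ?thesis by (simp add: NI_def)
qed

lemma subgroup_Int_class:
  assumes "group G"
  shows "subgroup (Int_class \<FF> G) G"
proof -
  interpret group G by fact
  have "subgroup (\<Inter>(insert (carrier G) {H. class_maximal \<FF> H G})) G"
    using subgroup_self by (intro subgroups_Inter) (auto simp: class_maximal_def)
  then show ?thesis by (simp add: Int_class_def)
qed

text \<open>If a prime \<open>p\<close> in \<pi> divided the order of the quotient, Cauchy's theorem
  would give a coset \<open>y\<close> of order \<open>p\<close>. A suitable power of a
  representative, with exponent prime to \<open>p\<close>, is a \<pi>-element and lies in
  \<open>Int_class\<close>, which is impossible.\<close>

lemma prime_divs_NI_Mod_Int: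
  assumes "group G" "finite (carrier G)"
    and nI: "Int_class \<FF> G \<lhd> G\<lparr>carrier := NI \<FF> G\<rparr>"
  shows "prime_divs (G\<lparr>carrier := NI \<FF> G\<rparr> Mod Int_class \<FF> G) \<subseteq> prime_compl (class_primes \<FF>)"
proof
  let ?N = "G\<lparr>carrier := NI \<FF> G\<rparr>" and ?I = "Int_class \<FF> G"
  interpret group G by fact
  interpret I: normal ?I ?N by fact
  interpret q: group_hom ?N "?N Mod ?I" "\<lambda>a. ?I #>\<^bsub>?N\<^esub> a"
    using I.r_coset_hom_Mod I.factorgroup_is_group
    by (simp add: group_hom_def group_hom_axioms_def I.group_axioms)
  fix p assume p: "p \<in> prime_divs (?N Mod ?I)"
  then have prime_p: "Factorial_Ring.prime p" by (simp add: prime_divs_def)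
  have "p \<notin> class_primes \<FF>"
  proof
    assume p\<pi>: "p \<in> class_primes \<FF>"
    have "finite (carrier (?N Mod ?I))"
      using finite_subset[OF _ assms(2), of "NI \<FF> G"] by (auto simp: carrier_FactGroup NI_def)
    then obtain y where y: "y \<in> carrier (?N Mod ?I)" "q.H.ord y = p"
      using q.H.exists_ord_eq_prime p by (auto simp: prime_divs_def)
    then obtain x where x: "x \<in> NI \<FF> G" "y = ?I #>\<^bsub>?N\<^esub> x" by (auto simp: carrier_FactGroup)
    have xG: "x \<in> carrier G" using x(1) by (simp add: NI_def)
    have "ord x \<noteq> 0" using ord_ge_1[OF assms(2) xG] by simp
    \<comment> \<open>Here \<open>m\<close> is the part of \<open>ord x\<close> prime to
      \<open>p\<close>. So \<open>x\<close> to the power \<open>m\<close> is a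
      \<open>p\<close>-element, while \<open>y\<close> to the power \<open>m\<close> cannot be
      trivial.\<close>
    then obtain m where m: "ord x = p ^ multiplicity p (ord x) * m" "\<not> p dvd m"
      using multiplicity_decompose'[of "ord x" p] prime_p not_prime_unit by metis
    let ?z = "x [^]\<^bsub>G\<^esub> m"
    have z: "?z \<in> carrier G" using xG by simp
    have "?z [^]\<^bsub>G\<^esub> (p ^ multiplicity p (ord x)) = x [^]\<^bsub>G\<^esub> ord x"
      unfolding nat_pow_pow[OF xG] using m(1) by (simp only: mult.commute)
    then have "?z [^]\<^bsub>G\<^esub> (p ^ multiplicity p (ord x)) = \<one>\<^bsub>G\<^esub>" using xG by simp
    then have dvd: "ord ?z dvd p ^ multiplicity p (ord x)" using pow_eq_id[OF z] by simp
    have "r = p" if r: "Factorial_Ring.prime r" "r dvd ord ?z" for r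
      using prime_dvd_power[OF r(1) dvd_trans[OF r(2) dvd]] r(1) prime_p primes_dvd_imp_eq by blast
    then have "?z \<in> class_elements G" using z p\<pi> by (auto simp: class_elements_def)
    moreover have zN: "?z = x [^]\<^bsub>?N\<^esub> m" using nat_pow_consistent by blast
    moreover have "x [^]\<^bsub>?N\<^esub> m \<in> NI \<FF> G" using I.nat_pow_closed[of x m] x(1) by simp
    ultimately have zI: "?z \<in> ?I" using Int_class_eq[OF assms(1,2)] by simp
    have "y [^]\<^bsub>?N Mod ?I\<^esub> m = ?I #>\<^bsub>?N\<^esub> ?z"
      unfolding x(2) zN by (rule q.hom_nat_pow[symmetric]) (use x in simp)
    also have "\<dots> = \<one>\<^bsub>?N Mod ?I\<^esub>"
      using I.coset_join2[OF _ I.subgroup_axioms zI] I.subset zI by auto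
    finally have "p dvd m" using q.H.pow_eq_id[OF y(1)] y(2) by simp
    then show False using m(2) by simp
  qed
  then show "p \<in> prime_compl (class_primes \<FF>)" using prime_p by (simp add: prime_compl_def)
qed

text \<open>Elements of \<open>Int_class\<close> are \<pi>-elements, and so are their images in the
  quotient by \<open>D\<close>. No prime in \<pi> divides the order of that quotient, so the images
  are trivial.\<close>

lemma Int_class_subset_of_prime_divs_quotient:
  assumes "group G" "finite (carrier G)" "D \<lhd> G\<lparr>carrier := NI \<FF> G\<rparr>"
    and "prime_divs (G\<lparr>carrier := NI \<FF> G\<rparr> Mod D) \<subseteq> prime_compl (class_primes \<FF>)"
  shows "Int_class \<FF> G \<subseteq> D"
proof
  let ?N = "G\<lparr>carrier := NI \<FF> G\<rparr>"
  interpret D: normal D ?N by fact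
  interpret q: group_hom ?N "?N Mod D" "\<lambda>a. D #>\<^bsub>?N\<^esub> a"
    using D.r_coset_hom_Mod D.factorgroup_is_group
    by (simp add: group_hom_def group_hom_axioms_def D.group_axioms)
  fix x assume "x \<in> Int_class \<FF> G"
  then have x: "x \<in> NI \<FF> G" "x \<in> class_elements ?N"
    using Int_class_eq[OF assms(1,2)] class_elements_subgroup[OF assms(1) subgroup_NI[OF assms(1)]]
    by auto
  let ?y = "D #>\<^bsub>?N\<^esub> x"
  have y: "?y \<in> carrier (?N Mod D)" using x(1) by (simp add: carrier_FactGroup)
  have cy: "?y \<in> class_elements (?N Mod D)" using class_elements_image[OF q.group_hom_axioms x(2)] .
  have "q.H.ord ?y = 1"
  proof (rule ccontr)
    assume "q.H.ord ?y \<noteq> 1"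
    then obtain p where p: "Factorial_Ring.prime p" "p dvd q.H.ord ?y" using prime_factor_nat by blast
    then have "p \<in> class_primes \<FF>" using cy by (simp add: class_elements_def)
    moreover have "p dvd order (?N Mod D)"
      using dvd_trans[OF p(2) q.H.ord_dvd_group_order[OF y]] .
    then have "p \<in> prime_compl (class_primes \<FF>)" using assms(4) p(1) by (auto simp: prime_divs_def)
    ultimately show False by (simp add: prime_compl_def)
  qed
  then have "?y = D" using q.H.ord_eq_1[OF y] by simp
  moreover have "x \<in> ?y" using D.rcos_self[OF _ D.subgroup_axioms] x(1) by simp
  ultimately show "x \<in> D" by simp
qed

end

theorem proposition1:
  fixes \<FF> :: group_class
    and \<pi> :: "nat set"
    and G :: "('a, 'b) monoid_scheme"
  assumes "\<FF> \<noteq> {}"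
    and "formation \<FF>"
    and "hereditary \<FF>"
    and "saturated \<FF>"
    and "\<pi> = class_primes \<FF>"
    and "group G"
    and "finite (carrier G)"
  shows "residual (prime_compl \<pi>) (G\<lparr>carrier := NI \<FF> G\<rparr>) = Int_class \<FF> G"
proof -
  interpret hs_formation \<FF> using assms by unfold_locales
  interpret group G by fact
  have eq: "Int_class \<FF> G = NI \<FF> G \<inter> class_elements G"
    using assms by (intro Int_class_eq)
  \<comment> \<open>Normality comes from the description \<open>eq\<close>: both sets on its
    right-hand side are invariant under conjugation.\<close>
  have "Int_class \<FF> G \<lhd> G"
    using NI_class_elements_conjugate[OF assms(6,7)] subgroup_Int_class[OF assms(6)]
    unfolding eq by (intro normal_invI)
  then have nI: "Int_class \<FF> G \<lhd> G\<lparr>carrier := NI \<FF> G\<rparr>"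
    using eq by (intro normal_restrict_supergroup subgroup_NI[OF assms(6)]) auto
  \<comment> \<open>The two halves of \<open>LEAST\<close>: the quotient by \<open>Int_class\<close>
    has no prime divisor in \<pi>, and every competing normal subgroup contains
    \<open>Int_class\<close>.\<close>
  show ?thesis
    unfolding residual_def assms(5)
    using nI prime_divs_NI_Mod_Int[OF assms(6,7) nI]
      Int_class_subset_of_prime_divs_quotient[OF assms(6,7)]
    by (intro Least_equality) auto
qed

end
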